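(* For any graph $G$ and integer $k\geq\max\{\mathrm{tw}(G),1\}$, there is a tree-decomposition of $G$ with width at most $3k-1$ and order at most $\max\{\frac{|V(G)|}{k}-1,1\}$.
   Context: Graphs are simple, undirected and finite. For a non-empty tree $T$, a $T$-decomposition of a graph $G$ is a collection $(B_x:x\in V(T))$ of subsets $B_x\subseteq V(G)$ (bags) such that for each edge $vw\in E(G)$ some bag contains both $v$ and $w$, and for each $v\in V(G)$ the set $\{x\in V(T):v\in B_x\}$ induces a non-empty connected subtree of $T$. A tree-decomposition is a $T$-decomposition for some tree $T$. Its width is $\max_x|B_x|-1$, and its order is $|V(T)|$. $\mathrm{tw}(G)$ denotes the treewidth of $G$, the minimum width of a tree-decomposition of $G$. *)

theory Defs
  imports Complex_Main "Graph_Theory.Graph_Theory"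
begin

text \<open>
  A finite simple undirected graph is a \<^locale>\<open>pair_graph\<close>: a finite, loop-free, symmetric relation
  \<^const>\<open>parcs\<close> on a finite (possibly empty) set \<^const>\<open>pverts\<close>, each undirected edge being
  represented by its two orientations.

  The library's \<^const>\<open>tree\<close> and \<^const>\<open>forest\<close> cannot be used for such graphs: they count the
  closed walk \<open>a, b, a\<close> along a single edge as a cycle. Cycles of the undirected graph are the
  directed cycles of length at least 3. Note that \<^const>\<open>connected\<close> includes
  non-emptiness.
\<close>

definition undirected_tree :: "'x pair_pre_digraph \<Rightarrow> bool" where
  "undirected_tree T \<longleftrightarrow>
     pair_graph T \<and> connected (with_proj T) \<and>
     \<not> (\<exists>p. pre_digraph.cycle (with_proj T) p \<and> 3 \<le> length p)"

text \<open>
  Only the values of \<open>B\<close> on the nodes of \<open>T\<close> matter. In the last condition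
  \<^const>\<open>connected\<close> again includes non-emptiness, and a connected subgraph of a tree is a subtree.
\<close>

definition tree_decomposition ::
    "'a pair_pre_digraph \<Rightarrow> 'x pair_pre_digraph \<Rightarrow> ('x \<Rightarrow> 'a set) \<Rightarrow> bool" where
  "tree_decomposition G T B \<longleftrightarrow>
     undirected_tree T \<and>
     (\<forall>x\<in>pverts T. B x \<subseteq> pverts G) \<and>
     (\<forall>(v, w)\<in>parcs G. \<exists>x\<in>pverts T. v \<in> B x \<and> w \<in> B x) \<and>
     (\<forall>v\<in>pverts G. connected (with_proj T \<restriction> {x \<in> pverts T. v \<in> B x}))"

text \<open>Integer-valued, since all bags are empty (width \<open>-1\<close>) when the graph has no vertices.\<close>

definition width :: "'x pair_pre_digraph \<Rightarrow> ('x \<Rightarrow> 'a set) \<Rightarrow> int" where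
  "width T B = Max ((\<lambda>x. int (card (B x))) ` pverts T) - 1"

definition order :: "'x pair_pre_digraph \<Rightarrow> nat" where
  "order T = card (pverts T)"

text \<open>
  Trees are finite, so every tree is isomorphic to one whose nodes are natural numbers, and the
  minimum over all trees is the minimum over trees with nodes in \<^typ>\<open>nat\<close>.
\<close>

definition treewidth :: "'a pair_pre_digraph \<Rightarrow> int" where
  "treewidth G =
     (LEAST w. \<exists>(T :: nat pair_pre_digraph) B. tree_decomposition G T B \<and> width T B = w)"

end

theory Submission
  imports Defs "HOL-Library.Disjoint_Sets"
begin

text \<open>
  Up to the shape of the tree, a tree-decomposition is a family of bags that can be built by
  repeatedly inserting a bag whose intersection with the union of the earlier ones lies in a single
  earlier bag (the running intersection property). Starting from bags of size at most \<open>k + 1\<close>,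
  remove leaf bags one by one, and let every remaining bag \<open>b\<close> carry the set \<open>P b\<close> of
  those vertices removed below it and not yet placed; this set always has fewer
  than \<open>k\<close> elements. When \<open>b\<close> is removed, \<open>W = (b - c) \<union> P b\<close> is to be passed on to
  its neighbour \<open>c\<close>. If \<open>W\<close> has at least \<open>k\<close> elements, \<open>b \<union> P b\<close> becomes a
  new leaf bag of size at most \<open>2 k\<close>; otherwise, if \<open>P c \<union> W\<close> has at least \<open>k\<close>
  elements, \<open>c \<union> P c \<union> W\<close> becomes a new leaf bag of size at most
  \<open>(k + 1) + 2 (k - 1) < 3 k\<close>. Each new bag thus uses up at least \<open>k\<close> vertices, and as soon as
  at most \<open>3 k\<close> vertices are left they are put into a single bag; hence
  \<open>k (m + 1) \<le> |V(G)|\<close> whenever the number \<open>m\<close> of bags is greater than 1.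
\<close>

section \<open>The running intersection property\<close>

text \<open>A set of bags rather than an indexed family: nodes with equal bags are merged, and the
  inserted bag may already be present.\<close>

inductive rip :: "'a set set \<Rightarrow> bool" where
  rip_singleton: "rip {b}"
| rip_insert: "rip \<B> \<Longrightarrow> c \<in> \<B> \<Longrightarrow> b \<inter> \<Union>\<B> \<subseteq> c \<Longrightarrow> rip (insert b \<B>)"

lemma rip_finite: "rip \<B> \<Longrightarrow> finite \<B>"
  by (induction rule: rip.induct) auto

text \<open>The disjunction expresses, without division, that the number of bags is at most
  \<open>max (card U / k - 1) 1\<close>. The bound \<open>3 * k\<close> on bag sizes corresponds to
  width \<open>3 * k - 1\<close>.\<close>

definition few_bags :: "nat \<Rightarrow> 'a set \<Rightarrow> 'a set set \<Rightarrow> bool" where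
  "few_bags k U \<C> \<longleftrightarrow> rip \<C> \<and> \<Union>\<C> = U \<and> (\<forall>c\<in>\<C>. card c \<le> 3 * k) \<and>
     (card \<C> \<le> 1 \<or> k * (card \<C> + 1) \<le> card U)"

lemma few_bags_singleton: "card U \<le> 3 * k \<Longrightarrow> few_bags k U {U}"
  by (simp add: few_bags_def rip_singleton)

text \<open>The new bag contributes at least \<open>k\<close> vertices outside \<open>U\<close>,
  which pays for the increase by one in the number of bags. When \<open>\<C>\<close> has at most one
  bag there is no earlier count to extend, and \<open>large\<close> supplies it instead.\<close>

lemma few_bags_insert:
  assumes \<C>: "few_bags k U \<C>" and d: "d \<in> \<C>" "N \<inter> U \<subseteq> d"
    and N: "card N \<le> 3 * k" "k \<le> card (N - U)"
    and fin: "finite U" "finite N" and large: "3 * k \<le> card (N \<union> U)"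
  shows "few_bags k (N \<union> U) (insert N \<C>)"
proof -
  have "finite \<C>"
    using \<C> rip_finite few_bags_def by blast
  then have le: "card (insert N \<C>) \<le> Suc (card \<C>)"
    by (simp add: card_insert_if)
  have "N \<union> U = (N - U) \<union> U" by blast
  then have U: "card (N \<union> U) = card (N - U) + card U"
    using fin by (metis Diff_disjoint card_Un_disjoint finite_Diff inf_commute)
  have "k * (card (insert N \<C>) + 1) \<le> k * (card \<C> + 2)"
    using le by (intro mult_left_mono) auto
  also have "\<dots> \<le> card (N \<union> U)"
  proof (cases "card \<C> \<le> 1")
    case True
    then have "k * (card \<C> + 2) \<le> k * 3" by (intro mult_left_mono) auto
    also have "\<dots> \<le> card (N \<union> U)" using large by (simp add: mult.commute)
    finally show ?thesis .
  next
    case False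
    then have "k * (card \<C> + 1) \<le> card U" using \<C> few_bags_def by blast
    with U N show ?thesis by (simp add: algebra_simps)
  qed
  finally have "k * (card (insert N \<C>) + 1) \<le> card (N \<union> U)" .
  moreover have "rip (insert N \<C>)"
    using \<C> d by (auto simp: few_bags_def intro: rip_insert)
  ultimately show ?thesis
    using \<C> N by (auto simp: few_bags_def)
qed

text \<open>\<open>P\<close> is general so that the induction hypothesis can be used with altered
  pending sets. Requiring one new bag to hold all of \<open>b \<union> P b\<close>, and not only
  \<open>b\<close>, ensures that a bag whose private vertices were passed to its neighbour is still
  covered.\<close>

lemma rip_coarsening_pending:
  assumes "rip \<B>" and "1 \<le> k"
    and "\<And>b. b \<in> \<B> \<Longrightarrow> finite b" "\<And>b. b \<in> \<B> \<Longrightarrow> card b \<le> k + 1"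
    and "\<And>b. b \<in> \<B> \<Longrightarrow> finite (P b)" "\<And>b. b \<in> \<B> \<Longrightarrow> card (P b) < k"
    and "\<And>b. b \<in> \<B> \<Longrightarrow> P b \<inter> \<Union>\<B> = {}" "disjoint_family_on P \<B>"
  shows "\<exists>\<C>. few_bags k (\<Union>b\<in>\<B>. b \<union> P b) \<C> \<and> (\<forall>b\<in>\<B>. \<exists>c\<in>\<C>. b \<union> P b \<subseteq> c)"
  using assms
proof (induction arbitrary: P rule: rip.induct)
  case (rip_singleton b)
  have "card (b \<union> P b) \<le> card b + card (P b)" by (rule card_Un_le)
  also have "\<dots> \<le> 3 * k"
    using rip_singleton.prems(3)[of b] rip_singleton.prems(5)[of b] \<open>1 \<le> k\<close> by simp
  finally show ?case using few_bags_singleton by fastforce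
next
  case (rip_insert \<B> c b)
  note fin = rip_insert.prems(2,4) and b_le = rip_insert.prems(3)
    and P_lt = rip_insert.prems(5) and P_disj = rip_insert.prems(6)
  have P_disj2: "P x \<inter> P y = {}" if "x \<in> insert b \<B>" "y \<in> insert b \<B>" "x \<noteq> y" for x y
    using rip_insert.prems(7) that unfolding disjoint_family_on_def by blast
  define U where "U = (\<Union>a\<in>insert b \<B>. a \<union> P a)"
  have finB: "finite \<B>" using rip_finite rip_insert.hyps by blast
  then have finU: "finite U" using fin by (auto simp: U_def)
  \<comment> \<open>Up to \<open>3 * k\<close> vertices fit into one bag. Beyond that, the premise
    \<open>large\<close> of \<open>few_bags_insert\<close> holds for any bag emitted below.\<close>
  consider "b \<in> \<B>" | "card U \<le> 3 * k" | "b \<notin> \<B>" "3 * k < card U" by linarith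
  then show ?case
  proof cases
    case 1
    then have "insert b \<B> = \<B>" by blast
    with rip_insert.IH[of P] rip_insert.prems show ?thesis by simp
  next
    case 2
    have "\<forall>a\<in>insert b \<B>. \<exists>c\<in>{U}. a \<union> P a \<subseteq> c" by (auto simp: U_def)
    then show ?thesis
      using few_bags_singleton[OF 2] unfolding U_def by blast
  next
    case 3
    define W where "W = (b - c) \<union> P b"
    have c: "c \<in> \<B>" "c \<noteq> b" using rip_insert.hyps 3 by auto
    have finW: "finite W" using fin by (simp add: W_def)
    have W_disj: "W \<inter> \<Union>\<B> = {}"
      using rip_insert.hyps(3) P_disj[of b] by (auto simp: W_def)
    have W_disj2: "W \<inter> P a = {}" if "a \<in> \<B>" for a
      using P_disj[of a] P_disj2[of b a] that 3 by (auto simp: W_def)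
    have bP: "b \<union> P b \<subseteq> c \<union> W" by (auto simp: W_def)
    \<comment> \<open>Only the pending set of \<open>c\<close> may change, and only within
      \<open>P c \<union> W\<close>. Since \<open>W\<close> misses all remaining bags and their
      pending sets, the disjointness conditions survive.\<close>
    have IH: "\<exists>\<C>. few_bags k (\<Union>b\<in>\<B>. b \<union> Q b) \<C> \<and> (\<forall>b\<in>\<B>. \<exists>c\<in>\<C>. b \<union> Q b \<subseteq> c)"
      if "\<And>a. a \<in> \<B> \<Longrightarrow> a \<noteq> c \<Longrightarrow> Q a = P a" "finite (Q c)" "card (Q c) < k"
        "Q c \<subseteq> P c \<union> W" for Q
    proof (rule rip_insert.IH)
      fix a assume a: "a \<in> \<B>"
      show "finite (Q a)" "card (Q a) < k" 
        using that(1-3) fin(2)[of a] P_lt[of a] a by (cases "a = c"; simp)+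
      show "Q a \<inter> \<Union>\<B> = {}"
      proof (cases "a = c")
        case True
        have "P c \<inter> \<Union>\<B> = {}" using P_disj[OF insertI2[OF c(1)]] by blast
        then show ?thesis using W_disj that(4) unfolding True by blast
      next
        case False
        with that(1) a P_disj[of a] show ?thesis by auto
      qed
    next
      have *: "Q c \<inter> P a = {}" if "a \<in> \<B>" "a \<noteq> c" for a
      proof -
        have "P c \<inter> P a = {}" using P_disj2[of c a] c that by auto
        with W_disj2[OF that(1)] \<open>Q c \<subseteq> _\<close> show ?thesis by blast
      qed
      show "disjoint_family_on Q \<B>"
        unfolding disjoint_family_on_def
      proof (intro ballI impI)
        fix x y assume xy: "x \<in> \<B>" "y \<in> \<B>" "x \<noteq> y"
        consider "x = c" | "y = c" | "x \<noteq> c" "y \<noteq> c" by blast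
        then show "Q x \<inter> Q y = {}"
        proof cases
          case 1
          then show ?thesis using *[of y] that(1)[of y] xy by simp
        next
          case 2
          then show ?thesis using *[of x] that(1)[of x] xy by (simp add: Int_commute)
        next
          case 3
          then show ?thesis using that(1)[of x] that(1)[of y] P_disj2[of x y] xy by simp
        qed
      qed
    qed (use rip_insert.prems in auto)
    consider (emit_b) "k \<le> card W" | (emit_c) "card W < k" "k \<le> card (P c \<union> W)"
      | (pass) "card (P c \<union> W) < k" by linarith
    then show ?thesis
    proof cases
      case emit_b
      obtain \<C> where \<C>: "few_bags k (\<Union>a\<in>\<B>. a \<union> P a) \<C>" "\<forall>a\<in>\<B>. \<exists>d\<in>\<C>. a \<union> P a \<subseteq> d"
        using IH[of P] fin(2)[of c] P_lt[of c] c by auto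
      then obtain d where d: "d \<in> \<C>" "c \<union> P c \<subseteq> d" using c by blast
      let ?U = "\<Union>a\<in>\<B>. a \<union> P a"
      have U: "U = (b \<union> P b) \<union> ?U" by (auto simp: U_def)
      have "few_bags k ((b \<union> P b) \<union> ?U) (insert (b \<union> P b) \<C>)"
      proof (rule few_bags_insert[OF \<C>(1) d(1)])
        \<comment> \<open>All of \<open>W\<close> is new, so the emitted bag meets the remaining
          vertices only inside \<open>c\<close>; its size is at most
          \<open>(k + 1) + (k - 1)\<close>.\<close>
        have "W \<inter> ?U = {}" using W_disj W_disj2 by blast
        then show "(b \<union> P b) \<inter> ?U \<subseteq> d" using bP d by blast
        have "W \<subseteq> b \<union> P b - ?U" using \<open>W \<inter> ?U = {}\<close> by (auto simp: W_def)
        then show "k \<le> card (b \<union> P b - ?U)"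
          using emit_b fin by (meson card_mono finite_Diff finite_UnI insertI1 le_trans)
        have "card (b \<union> P b) \<le> card b + card (P b)" by (rule card_Un_le)
        then show "card (b \<union> P b) \<le> 3 * k"
          using b_le[of b] P_lt[of b] \<open>1 \<le> k\<close> by simp
      qed (use fin finU 3 U in auto)
      moreover have "\<forall>a\<in>insert b \<B>. \<exists>d\<in>insert (b \<union> P b) \<C>. a \<union> P a \<subseteq> d"
        using \<C>(2) by blast
      ultimately show ?thesis using U unfolding U_def by metis
    next
      case emit_c
      \<comment> \<open>The emitted bag absorbs everything pending at \<open>c\<close>;
        \<open>c\<close> itself stays among the remaining bags and is the place where the new bag is
        attached.\<close>
      let ?Q = "P(c := {})"
      obtain \<C> where \<C>: "few_bags k (\<Union>a\<in>\<B>. a \<union> ?Q a) \<C>" "\<forall>a\<in>\<B>. \<exists>d\<in>\<C>. a \<union> ?Q a \<subseteq> d"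
        using IH[of ?Q] \<open>1 \<le> k\<close> c by auto
      then obtain d where d: "d \<in> \<C>" "c \<subseteq> d" using c by blast
      let ?U = "\<Union>a\<in>\<B>. a \<union> ?Q a" and ?N = "c \<union> (P c \<union> W)"
      have U: "U = ?N \<union> ?U"
        using c by (auto simp: U_def W_def split: if_splits)
      have "few_bags k (?N \<union> ?U) (insert ?N \<C>)"
      proof (rule few_bags_insert[OF \<C>(1) d(1)])
        have "P c \<inter> a = {}" if "a \<in> \<B>" for a using P_disj[of c] c that by blast
        moreover have "P c \<inter> ?Q a = {}" if "a \<in> \<B>" for a using P_disj2[of c a] c that by auto
        moreover have "W \<inter> ?Q a = {}" if "a \<in> \<B>" for a using W_disj2[of a] that by auto
        ultimately have *: "(P c \<union> W) \<inter> ?U = {}" using W_disj by blast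
        then show "?N \<inter> ?U \<subseteq> d" using d by blast
        have "P c \<union> W \<subseteq> ?N - ?U" using * by blast
        then show "k \<le> card (?N - ?U)"
          using emit_c fin finW c by (meson card_mono finite_Diff finite_UnI insertCI le_trans)
        have "card ?N \<le> card c + (card (P c) + card W)"
          by (meson add_left_mono card_Un_le le_trans)
        then show "card ?N \<le> 3 * k"
          using b_le[of c] P_lt[of c] emit_c c by simp
      qed (use fin finU finW 3 U c in auto)
      moreover have "\<forall>a\<in>insert b \<B>. \<exists>d\<in>insert ?N \<C>. a \<union> P a \<subseteq> d"
      proof
        fix a assume "a \<in> insert b \<B>"
        then consider "a = b" | "a = c" | "a \<in> \<B>" "a \<noteq> c" by blast
        then show "\<exists>d\<in>insert ?N \<C>. a \<union> P a \<subseteq> d"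
        proof cases
          case 1
          then have "a \<union> P a \<subseteq> ?N" using bP by auto
          then show ?thesis by (rule bexI) simp
        next
          case 2
          then have "a \<union> P a \<subseteq> ?N" by auto
          then show ?thesis by (rule bexI) simp
        next
          case 3
          then show ?thesis using bspec[OF \<C>(2), of a] by simp
        qed
      qed
      ultimately show ?thesis using U unfolding U_def by metis
    next
      case pass
      let ?Q = "P(c := P c \<union> W)"
      obtain \<C> where \<C>: "few_bags k (\<Union>a\<in>\<B>. a \<union> ?Q a) \<C>" "\<forall>a\<in>\<B>. \<exists>d\<in>\<C>. a \<union> ?Q a \<subseteq> d"
        using IH[of ?Q] pass fin finW c by auto
      have "U = (\<Union>a\<in>\<B>. a \<union> ?Q a)"
        using c by (auto simp: U_def W_def split: if_splits)
      moreover have "\<exists>d\<in>\<C>. a \<union> P a \<subseteq> d" if "a \<in> insert b \<B>" for a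
      proof -
        \<comment> \<open>No bag is emitted: \<open>b\<close> with its pending set is covered by
          \<open>c\<close> with its enlarged one.\<close>
        have "\<exists>a'\<in>\<B>. a \<union> P a \<subseteq> a' \<union> ?Q a'"
        proof (cases "a = b")
          case True
          then show ?thesis using bP c by (intro bexI[of _ c]) auto
        next
          case False
          then show ?thesis using that by (intro bexI[of _ a]) auto
        qed
        then show ?thesis using \<C>(2) by (meson subset_trans)
      qed
      ultimately show ?thesis using \<C>(1) unfolding U_def by metis
    qed
  qed
qed

lemma rip_coarsening:
  assumes "rip \<B>" "1 \<le> k" "\<And>b. b \<in> \<B> \<Longrightarrow> finite b" "\<And>b. b \<in> \<B> \<Longrightarrow> card b \<le> k + 1"
  obtains \<C> where "few_bags k (\<Union>\<B>) \<C>" "\<And>b. b \<in> \<B> \<Longrightarrow> \<exists>c\<in>\<C>. b \<subseteq> c"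
  using rip_coarsening_pending[OF assms, of "\<lambda>_. {}"] \<open>1 \<le> k\<close>
  by (auto simp: disjoint_family_on_def)

section \<open>Connectedness and acyclicity relative to a vertex set\<close>

text \<open>Connectedness in terms of cuts, which is convenient for adding and removing leaves.\<close>

definition linked :: "('x \<times> 'x) set \<Rightarrow> 'x set \<Rightarrow> bool" where
  "linked E S \<longleftrightarrow> S \<noteq> {} \<and>
     (\<forall>A \<subseteq> S. A \<noteq> {} \<longrightarrow> A \<noteq> S \<longrightarrow> (\<exists>a\<in>A. \<exists>b\<in>S - A. (a, b) \<in> E))"

text \<open>A cycle is encoded by its list of vertices instead of its list of arcs; the
  \<open>mod\<close> adds the edge from the last vertex back to the first.\<close>

definition acyclic_on :: "('x \<times> 'x) set \<Rightarrow> 'x set \<Rightarrow> bool" where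
  "acyclic_on E V \<longleftrightarrow> \<not> (\<exists>vs. set vs \<subseteq> V \<and> distinct vs \<and> 3 \<le> length vs \<and>
     (\<forall>i<length vs. (vs ! i, vs ! (Suc i mod length vs)) \<in> E))"

text \<open>A walk from inside \<open>A\<close> to outside must leave \<open>A\<close> along some
  edge. Conversely, the set of vertices reachable from \<open>u\<close> has no outgoing edge, so it
  cannot be a proper subset.\<close>

lemma rtrancl_on_iff_linked:
  assumes "sym E"
  shows "S \<noteq> {} \<and> (\<forall>u\<in>S. \<forall>v\<in>S. (u, v) \<in> rtrancl_on S E) \<longleftrightarrow> linked E S" (is "?L \<longleftrightarrow> _")
proof
  assume L: ?L
  have "\<exists>a\<in>A. \<exists>b\<in>S - A. (a, b) \<in> E" if A: "A \<subseteq> S" "A \<noteq> {}" "A \<noteq> S" for A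
  proof (rule ccontr)
    assume no: "\<not> ?thesis"
    obtain u v where uv: "u \<in> A" "v \<in> S - A" using A by blast
    with L A have "(u, v) \<in> rtrancl_on S E" by blast
    then have "v \<in> A"
      by (induction rule: rtrancl_on_induct) (use no uv in auto)
    with uv show False by blast
  qed
  with L show "linked E S" by (simp add: linked_def)
next
  assume linked: "linked E S"
  have "(u, v) \<in> rtrancl_on S E" if "u \<in> S" "v \<in> S" for u v
  proof (rule ccontr)
    assume no: "\<not> ?thesis"
    let ?A = "{w \<in> S. (u, w) \<in> rtrancl_on S E}"
    have "?A \<subseteq> S" "?A \<noteq> {}" "?A \<noteq> S" using that no by auto
    then obtain a b where "a \<in> ?A" "b \<in> S - ?A" "(a, b) \<in> E"
      using linked unfolding linked_def by meson
    then show False by (auto intro: rtrancl_on_into_rtrancl_on)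
  qed
  then show ?L using linked by (simp add: linked_def)
qed

lemma connected_restrict_iff:
  assumes "sym (parcs T)" "S \<subseteq> pverts T"
  shows "connected (with_proj T \<restriction> S) \<longleftrightarrow> linked (parcs T) S"
proof -
  have ends: "parcs (mk_symmetric (with_proj T \<restriction> S)) = parcs T \<inter> S \<times> S"
    using assms(1) by (auto simp: mk_symmetric_def induce_subgraph_def sym_def)
  have verts: "pverts (mk_symmetric (with_proj T \<restriction> S)) = S"
    by (simp add: mk_symmetric_def induce_subgraph_def)
  have "sym (parcs T \<inter> S \<times> S)" using assms(1) by (auto simp: sym_def)
  then have "connected (with_proj T \<restriction> S) \<longleftrightarrow> linked (parcs T \<inter> S \<times> S) S"
    by (simp add: connected_def strongly_connected_def reachable_def ends verts
        rtrancl_on_iff_linked[symmetric])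
  \<comment> \<open>Crossing edges of a cut of \<open>S\<close> have both ends in \<open>S\<close>,
    so restricting the relation changes nothing.\<close>
  also have "\<dots> \<longleftrightarrow> linked (parcs T) S"
    unfolding linked_def by blast
  finally show ?thesis .
qed

lemma connected_iff_linked:
  assumes "pair_graph T"
  shows "connected (with_proj T) \<longleftrightarrow> linked (parcs T) (pverts T)"
proof -
  interpret pair_graph T by fact
  have "with_proj T \<restriction> pverts T = with_proj T"
    by (auto simp: induce_subgraph_def with_proj_def dest: in_arcsD1 in_arcsD2)
  moreover have "sym (parcs T)" using pair_sym_arcs by (simp add: symmetric_def)
  ultimately show ?thesis using connected_restrict_iff[of T "pverts T"] by simp
qed

section \<open>Directed cycles as cyclic lists of vertices\<close>

lemma pcas_iff:
  "pcas u p v \<longleftrightarrow> (if p = [] then u = v else fst (hd p) = u \<and> snd (last p) = v \<and>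
     (\<forall>i. Suc i < length p \<longrightarrow> fst (p ! Suc i) = snd (p ! i)))"
proof (induction p arbitrary: u)
  case (Cons e p)
  show ?case
  proof (cases p)
    case (Cons e' p')
    have "(\<forall>i. Suc i < length (e # p) \<longrightarrow> fst ((e # p) ! Suc i) = snd ((e # p) ! i)) \<longleftrightarrow>
        fst (hd p) = snd e \<and> (\<forall>i. Suc i < length p \<longrightarrow> fst (p ! Suc i) = snd (p ! i))"
      (is "?L \<longleftrightarrow> ?R")
    proof
      assume L: ?L
      have "fst (p ! Suc i) = snd (p ! i)" if "Suc i < length p" for i
        using L[rule_format, of "Suc i"] that by simp
      with L[rule_format, of 0] Cons show ?R by simp
    next
      assume R: ?R
      then show ?L using Cons by (auto simp: nth_Cons split: nat.split)
    qed
    with Cons.IH[of "snd e"] Cons show ?thesis by auto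
  qed auto
qed simp

lemma pawalk_verts_pcas: "pcas u p v \<Longrightarrow> pawalk_verts u p = u # map snd p"
  by (induction p arbitrary: u) auto

text \<open>The heads of the arcs of a cycle form the cyclic vertex list; conversely, the arcs join
  cyclically consecutive vertices of the list.\<close>

lemma cycle_iff_acyclic_on:
  assumes "pair_graph T"
  shows "(\<exists>p. pre_digraph.cycle (with_proj T) p \<and> 3 \<le> length p) \<longleftrightarrow>
    \<not> acyclic_on (parcs T) (pverts T)"
proof -
  interpret pair_graph T by fact
  show ?thesis
  proof
    assume "\<exists>p. cycle p \<and> 3 \<le> length p"
    then obtain p u where p: "set p \<subseteq> parcs T" "pcas u p u"
      "distinct (tl (pawalk_verts u p))" "3 \<le> length p"
      unfolding cycle_def awalk_def by auto
    let ?vs = "map snd p"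
    from p have "p \<noteq> []" by auto
    with p have cas: "fst (hd p) = u" "snd (last p) = u"
      "\<And>i. Suc i < length p \<Longrightarrow> fst (p ! Suc i) = snd (p ! i)"
      unfolding pcas_iff by auto
    have "(?vs ! i, ?vs ! (Suc i mod length ?vs)) \<in> parcs T" if "i < length ?vs" for i
    proof -
      have "fst (p ! (Suc i mod length p)) = snd (p ! i)"
      proof (cases "Suc i < length p")
        case True
        then show ?thesis using cas by simp
      next
        \<comment> \<open>The wrap-around: the last arc ends at \<open>u\<close>, where the first
          one starts.\<close>
        case False
        with that have "Suc i = length p" by simp
        then have "i = length p - 1" by simp
        with \<open>Suc i = length p\<close> \<open>p \<noteq> []\<close> cas(1,2) show ?thesis
          by (simp add: hd_conv_nth last_conv_nth)
      qed
      moreover have "Suc i mod length p < length p" using \<open>p \<noteq> []\<close> by simp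
      ultimately show ?thesis
        using p(1) that nth_mem[of "Suc i mod length p" p]
        by (metis length_map nth_map prod.collapse subsetD)
    qed
    moreover have "set ?vs \<subseteq> pverts T" using p(1) in_arcsD2 by force
    moreover have "distinct ?vs" using p pawalk_verts_pcas by fastforce
    ultimately show "\<not> acyclic_on (parcs T) (pverts T)"
      using p(4) unfolding acyclic_on_def by (metis length_map)
  next
    assume "\<not> acyclic_on (parcs T) (pverts T)"
    then obtain vs where vs: "set vs \<subseteq> pverts T" "distinct vs" "3 \<le> length vs"
      "\<And>i. i < length vs \<Longrightarrow> (vs ! i, vs ! (Suc i mod length vs)) \<in> parcs T"
      unfolding acyclic_on_def by auto
    define p where "p = map (\<lambda>i. (vs ! i, vs ! (Suc i mod length vs))) [0..<length vs]"
    have len: "length p = length vs" by (simp add: p_def)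
    have nth: "p ! i = (vs ! i, vs ! (Suc i mod length vs))" if "i < length vs" for i
      using that by (simp add: p_def)
    have ne: "vs \<noteq> []" "p \<noteq> []" using vs(3) len by auto
    have "hd p = (vs ! 0, vs ! 1)" "last p = (vs ! (length vs - 1), vs ! 0)"
      using vs(3) by (simp_all add: hd_conv_nth[OF ne(2)] last_conv_nth[OF ne(2)] len nth ne(1))
    then have cas: "pcas (vs ! 0) p (vs ! 0)"
      unfolding pcas_iff using ne by (simp add: len nth)
    \<comment> \<open>The first arc ends at \<open>vs ! 1\<close>, so the heads are
      \<open>vs\<close> shifted by one, and distinctness carries over.\<close>
    have "map snd p = rotate1 vs"
      by (rule nth_equalityI) (use ne in \<open>simp_all add: len nth nth_rotate1\<close>)
    then have "distinct (tl (pawalk_verts (vs ! 0) p))"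
      using pawalk_verts_pcas[OF cas] vs(2) by simp
    moreover have "set p \<subseteq> parcs T" using vs(4) by (auto simp: p_def)
    moreover have "vs ! 0 \<in> pverts T" using vs(1) ne by auto
    ultimately have "cycle p" using cas ne unfolding cycle_def awalk_def by blast
    then show "\<exists>p. cycle p \<and> 3 \<le> length p" using vs(3) len by auto
  qed
qed

lemma undirected_tree_iff:
  "undirected_tree T \<longleftrightarrow> pair_graph T \<and> linked (parcs T) (pverts T) \<and> acyclic_on (parcs T) (pverts T)"
  unfolding undirected_tree_def using connected_iff_linked cycle_iff_acyclic_on by blast

section \<open>Leaves\<close>

text \<open>A cut either separates \<open>x\<close> from all of \<open>S\<close>, and then the edge
  between \<open>x\<close> and \<open>y\<close> crosses it, or it already cuts
  \<open>S\<close>.\<close>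

lemma linked_insert_leaf:
  assumes "linked E S" "y \<in> S" "(x, y) \<in> E" "(y, x) \<in> E"
  shows "linked E (insert x S)"
  unfolding linked_def
proof (intro conjI allI impI)
  fix A assume A: "A \<subseteq> insert x S" "A \<noteq> {}" "A \<noteq> insert x S"
  consider "A \<inter> S = {}" | "S \<subseteq> A" | "A \<inter> S \<noteq> {}" "A \<inter> S \<noteq> S" by blast
  then show "\<exists>a\<in>A. \<exists>b\<in>insert x S - A. (a, b) \<in> E"
  proof cases
    case 1
    then have "A = {x}" "y \<notin> A" using A assms(2) by auto
    then show ?thesis using assms by blast
  next
    case 2
    then have "x \<notin> A" using A by blast
    then show ?thesis using 2 assms by blast
  next
    case 3
    then obtain a b where "a \<in> A \<inter> S" "b \<in> S - A \<inter> S" "(a, b) \<in> E"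
      using assms(1) unfolding linked_def by (meson inf_le2)
    then show ?thesis by blast
  qed
qed simp

text \<open>Given a cut of \<open>S - {x}\<close>, put \<open>x\<close> on the side of
  \<open>y\<close>. The edge that crosses the resulting cut of \<open>S\<close> cannot involve
  \<open>x\<close>, whose only possible neighbour in \<open>S\<close> is \<open>y\<close>. The cut
  \<open>{x}\<close> shows that \<open>y\<close> does lie in \<open>S\<close>.\<close>

lemma linked_remove_leaf:
  assumes "linked E S" "sym E" "x \<in> S" "S \<noteq> {x}" "\<And>z. z \<in> S \<Longrightarrow> (x, z) \<in> E \<Longrightarrow> z = y"
  shows "linked E (S - {x})" and "y \<in> S"
proof -
  have cut: "\<exists>a\<in>A. \<exists>b\<in>S - A. (a, b) \<in> E" if "A \<subseteq> S" "A \<noteq> {}" "A \<noteq> S" for A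
    using assms(1) that unfolding linked_def by blast
  show "y \<in> S" using cut[of "{x}"] assms(3-5) by auto
  have "\<exists>a\<in>A. \<exists>b\<in>S - {x} - A. (a, b) \<in> E"
    if A: "A \<subseteq> S - {x}" "A \<noteq> {}" "A \<noteq> S - {x}" for A
  proof (cases "y \<in> A")
    case True
    have "insert x A \<subseteq> S" "insert x A \<noteq> S" using A assms(3) by blast+
    then obtain a b where ab: "a \<in> insert x A" "b \<in> S - insert x A" "(a, b) \<in> E"
      using cut[of "insert x A"] by blast
    then have "a \<noteq> x" using assms(5)[of b] True by blast
    with ab show ?thesis by blast
  next
    case False
    have "A \<subseteq> S" "A \<noteq> S" using A assms(3) by blast+
    then obtain a b where ab: "a \<in> A" "b \<in> S - A" "(a, b) \<in> E"
      using cut[of A] A(2) by blast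
    then have "b \<noteq> x" using assms(2,5) False A by (metis (no_types) Diff_iff subsetD symD)
    with ab show ?thesis by blast
  qed
  moreover have "S - {x} \<noteq> {}" using assms(3,4) by blast
  ultimately show "linked E (S - {x})" unfolding linked_def by blast
qed

lemma acyclic_on_subset: "acyclic_on E V \<Longrightarrow> W \<subseteq> V \<Longrightarrow> acyclic_on E W"
  unfolding acyclic_on_def by (meson subset_trans)

text \<open>On a cycle through \<open>x\<close>, both the predecessor and the successor of
  \<open>x\<close> would be \<open>y\<close>, but in a list of length at least 3 these are different
  positions.\<close>

lemma acyclic_on_insert_leaf:
  assumes "acyclic_on E V" "\<And>z. (x, z) \<in> E \<Longrightarrow> z = y" "\<And>z. (z, x) \<in> E \<Longrightarrow> z = y"
  shows "acyclic_on E (insert x V)"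
  unfolding acyclic_on_def
proof
  assume "\<exists>vs. set vs \<subseteq> insert x V \<and> distinct vs \<and> 3 \<le> length vs \<and>
     (\<forall>i<length vs. (vs ! i, vs ! (Suc i mod length vs)) \<in> E)"
  then obtain vs where vs: "set vs \<subseteq> insert x V" "distinct vs" "3 \<le> length vs"
    "\<And>i. i < length vs \<Longrightarrow> (vs ! i, vs ! (Suc i mod length vs)) \<in> E" by blast
  show False
  proof (cases "x \<in> set vs")
    case False
    then have "set vs \<subseteq> V" using vs by auto
    with vs assms(1) show False unfolding acyclic_on_def by blast
  next
    case True
    let ?n = "length vs"
    obtain i where i: "i < ?n" "vs ! i = x" using True by (meson in_set_conv_nth)
    \<comment> \<open>The cyclic predecessor of \<open>i\<close>; the case split avoids truncated
      subtraction at 0.\<close>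
    define j where "j = (if i = 0 then ?n - 1 else i - 1)"
    have j: "j < ?n" "Suc j mod ?n = i" using i by (auto simp: j_def)
    have "Suc i mod ?n < ?n" using i by (intro mod_less_divisor) auto
    moreover have "vs ! (Suc i mod ?n) = y" using assms(2) vs(4)[OF i(1)] i(2) by metis
    moreover have "vs ! j = y" using assms(3) vs(4)[OF j(1)] j(2) i(2) by metis
    ultimately have "Suc i mod ?n = j"
      using vs(2) j(1) by (metis nth_eq_iff_index_eq)
    moreover have "Suc i mod ?n \<noteq> j"
      using i vs(3) by (cases "Suc i = ?n") (auto simp: j_def)
    ultimately show False by contradiction
  qed
qed

text \<open>The first vertex of a longest path is a leaf.\<close>

lemma acyclic_on_leaf:
  assumes "acyclic_on E V" "linked E V" "finite V" "sym E" "irrefl E" "V \<noteq> {v}" "v \<in> V"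
  obtains x y where "x \<in> V" "y \<in> V" "x \<noteq> y" "(x, y) \<in> E" "\<And>z. z \<in> V \<Longrightarrow> (x, z) \<in> E \<Longrightarrow> z = y"
proof -
  define path where "path = (\<lambda>vs. set vs \<subseteq> V \<and> distinct vs \<and>
    (\<forall>i. Suc i < length vs \<longrightarrow> (vs ! i, vs ! Suc i) \<in> E))"
  \<comment> \<open>A path on two vertices exists, so a longest path has a first edge, from
    \<open>x\<close> to \<open>y\<close>.\<close>
  obtain w where w: "w \<in> V - {v}" "(v, w) \<in> E"
    using assms(2,6,7) unfolding linked_def by (metis empty_subsetI insert_not_empty insert_subset singletonD)
  then have "path [v, w]" using assms(7) by (auto simp: path_def)
  moreover have "length vs \<le> card V" if "path vs" for vs
    using that assms(3) unfolding path_def by (metis card_mono distinct_card)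
  ultimately obtain vs where vs: "path vs" and max: "\<And>ws. path ws \<Longrightarrow> length ws \<le> length vs"
    using ex_has_greatest_nat[of path "[v, w]" length "Suc (card V)"] by (auto simp: less_Suc_eq_le)
  have "2 \<le> length vs" using max[OF \<open>path [v, w]\<close>] by simp
  then obtain x y us where vs_eq: "vs = x # y # us"
    by (cases vs; cases "tl vs") auto
  have xy: "x \<in> V" "y \<in> V" "x \<noteq> y" using vs by (auto simp: path_def vs_eq)
  have "(x, y) \<in> E" using vs by (force simp: path_def vs_eq)
  moreover have "z = y" if z: "z \<in> V" "(x, z) \<in> E" for z
  proof (rule ccontr)
    assume "z \<noteq> y"
    have "(z, x) \<in> E" using z assms(4) by (meson symD)
    show False
    proof (cases "z \<in> set vs")
      case False
      \<comment> \<open>A neighbour off the path would prolong it.\<close>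
      then have "path (z # vs)"
        using vs z \<open>(z, x) \<in> E\<close> by (auto simp: path_def vs_eq nth_Cons split: nat.splits)
      with max show False by fastforce
    next
      case True
      then obtain j where j: "j < length vs" "vs ! j = z" by (meson in_set_conv_nth)
      have "z \<noteq> x" using z assms(5) by (auto simp: irrefl_def)
      then have "2 \<le> j" using j \<open>z \<noteq> y\<close> by (cases j; cases "j - 1") (auto simp: vs_eq)
      \<comment> \<open>A second neighbour of \<open>x\<close> on the path, at position
        \<open>j\<close>, closes the prefix up to \<open>j\<close> into a cycle of length
        \<open>j + 1\<close>, at least 3.\<close>
      let ?c = "take (Suc j) vs"
      have len: "length ?c = Suc j" using j by simp
      have "(?c ! i, ?c ! (Suc i mod length ?c)) \<in> E" if "i < length ?c" for i
      proof (cases "i = j")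
        case True
        moreover have "?c ! 0 = x" by (simp add: vs_eq)
        ultimately show ?thesis using len j \<open>(z, x) \<in> E\<close> by (metis lessI mod_self nth_take)
      next
        case False
        then have "i < j" using that len by simp
        then show ?thesis using len j vs by (simp add: path_def)
      qed
      moreover have "set ?c \<subseteq> V" "distinct ?c"
        using vs set_take_subset[of "Suc j" vs] by (auto simp: path_def)
      ultimately show False
        using assms(1) \<open>2 \<le> j\<close> len unfolding acyclic_on_def by (metis Suc_le_mono numeral_3_eq_3 numeral_2_eq_2)
    qed
  qed
  ultimately show thesis using that xy by blast
qed

section \<open>Tree-decompositions\<close>

text \<open>Induction by removing a leaf \<open>x\<close> with neighbour \<open>y\<close>. If a
  vertex of \<open>B x\<close> occurs in another bag, its nodes form a connected set containing
  \<open>x\<close> and something else, hence also \<open>y\<close>; so \<open>B y\<close> contains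
  the intersection.\<close>

lemma rip_of_tree:
  assumes "finite V" "sym E" "irrefl E" "linked E V" "acyclic_on E V"
    and "\<And>v. v \<in> (\<Union>x\<in>V. B x) \<Longrightarrow> linked E {x \<in> V. v \<in> B x}"
  shows "rip (B ` V)"
  using assms
proof (induction "card V" arbitrary: V rule: less_induct)
  case less
  obtain r where r: "r \<in> V" using less.prems(4) by (auto simp: linked_def)
  show ?case
  proof (cases "V = {r}")
    case True
    then show ?thesis by (simp add: rip_singleton)
  next
    case False
    obtain x y where xy: "x \<in> V" "y \<in> V" "x \<noteq> y" "\<And>z. z \<in> V \<Longrightarrow> (x, z) \<in> E \<Longrightarrow> z = y"
      using acyclic_on_leaf[OF less.prems(5,4,1,2,3) False r] by metis
    have "V \<noteq> {x}" using xy by blast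
    have "rip (B ` (V - {x}))"
    proof (rule less.hyps)
      show "linked E (V - {x})"
        using linked_remove_leaf[OF less.prems(4,2) xy(1) \<open>V \<noteq> {x}\<close> xy(4)] by blast
      show "acyclic_on E (V - {x})" using less.prems(5) by (rule acyclic_on_subset) blast
      fix v assume v: "v \<in> (\<Union>x\<in>V - {x}. B x)"
      let ?S = "{x \<in> V. v \<in> B x}"
      have S: "linked E ?S" using less.prems(6) v by blast
      have "{z \<in> V - {x}. v \<in> B z} = (if x \<in> ?S then ?S - {x} else ?S)" by auto
      moreover have "linked E (?S - {x})" if "x \<in> ?S"
        using linked_remove_leaf(1)[OF S less.prems(2) that, of y] v xy(4) by blast
      ultimately show "linked E {z \<in> V - {x}. v \<in> B z}" using S by simp
    next
      show "card (V - {x}) < card V" using less.prems(1) xy(1) by (rule card_Diff1_less)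
    qed (use less.prems in auto)
    moreover have "B y \<in> B ` (V - {x})" using xy by blast
    moreover have "B x \<inter> \<Union>(B ` (V - {x})) \<subseteq> B y"
    proof
      fix v assume v: "v \<in> B x \<inter> \<Union>(B ` (V - {x}))"
      let ?S = "{x \<in> V. v \<in> B x}"
      have "linked E ?S" using less.prems(6) v by blast
      moreover have "x \<in> ?S" "?S \<noteq> {x}" using v xy by blast+
      ultimately have "y \<in> ?S"
        using linked_remove_leaf(2)[of E ?S x y] less.prems(2) xy(4) by blast
      then show "v \<in> B y" by blast
    qed
    ultimately have "rip (insert (B x) (B ` (V - {x})))" by (rule rip_insert)
    then show ?thesis using xy(1) by (metis image_insert insert_Diff)
  qed
qed

text \<open>Each inserted bag becomes a fresh leaf attached to the node of \<open>c\<close>. Bags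
  already present get no new node; this keeps \<open>B\<close> injective, so that nodes can be
  counted by bags.\<close>

lemma tree_of_rip:
  assumes "rip \<B>"
  shows "\<exists>(V :: nat set) E B. finite V \<and> E \<subseteq> V \<times> V \<and> sym E \<and> irrefl E \<and>
    linked E V \<and> acyclic_on E V \<and> inj_on B V \<and> B ` V = \<B> \<and>
    (\<forall>v\<in>\<Union>\<B>. linked E {x \<in> V. v \<in> B x})"
  using assms
proof (induction rule: rip.induct)
  case (rip_singleton b)
  have lin: "linked {} {0::nat}" by (auto simp: linked_def)
  have "acyclic_on {} {0::nat}"
    unfolding acyclic_on_def by (metis empty_iff length_greater_0_conv list.size(3) not_numeral_le_zero)
  with lin show ?case
    by (intro exI[of _ "{0}"] exI[of _ "{}"] exI[of _ "\<lambda>_. b"]) (auto simp: sym_def irrefl_def)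
next
  case (rip_insert \<B> c b)
  from rip_insert.IH obtain V :: "nat set" and E B where T: "finite V" "E \<subseteq> V \<times> V" "sym E" "irrefl E"
    "linked E V" "acyclic_on E V" "inj_on B V" "B ` V = \<B>"
    "\<forall>v\<in>\<Union>\<B>. linked E {x \<in> V. v \<in> B x}"
    by (elim exE conjE)
  show ?case
  proof (cases "b \<in> \<B>")
    case True
    then show ?thesis using rip_insert.IH by (simp add: insert_absorb)
  next
    case False
    obtain x where x: "x \<notin> V" using T(1) ex_new_if_finite[of V] by auto
    obtain y where y: "y \<in> V" "B y = c" using rip_insert.hyps(2) T(8) by blast
    let ?E = "E \<union> {(x, y), (y, x)}" and ?V = "insert x V" and ?B = "B(x := b)"
    have linkedE: "linked ?E S" if "linked E S" for S
      using that unfolding linked_def by blast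
    have "acyclic_on ?E V"
      unfolding acyclic_on_def
    proof
      assume "\<exists>vs. set vs \<subseteq> V \<and> distinct vs \<and> 3 \<le> length vs \<and>
        (\<forall>i<length vs. (vs ! i, vs ! (Suc i mod length vs)) \<in> ?E)"
      then obtain vs where vs: "set vs \<subseteq> V" "distinct vs" "3 \<le> length vs"
        "\<And>i. i < length vs \<Longrightarrow> (vs ! i, vs ! (Suc i mod length vs)) \<in> ?E" by blast
      \<comment> \<open>A cycle inside \<open>V\<close> avoids \<open>x\<close>, hence both new
        arcs.\<close>
      have "(vs ! i, vs ! (Suc i mod length vs)) \<in> E" if "i < length vs" for i
      proof -
        have "Suc i mod length vs < length vs" using that by (intro mod_less_divisor) auto
        then have "vs ! i \<in> V" "vs ! (Suc i mod length vs) \<in> V"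
          using vs(1) that by auto
        then show ?thesis using vs(4)[OF that] x by auto
      qed
      with vs(1-3) T(6) show False unfolding acyclic_on_def by blast
    qed
    then have "acyclic_on ?E ?V"
      by (rule acyclic_on_insert_leaf[where y = y]) (use x y T(2) in auto)
    moreover have "linked ?E ?V"
      using linked_insert_leaf[OF linkedE[OF T(5)] y(1)] by blast
    moreover have "inj_on ?B ?V"
      using T(7,8) x False by (auto simp: inj_on_def)
    moreover have "?B ` ?V = insert b \<B>" using T(8) x by auto
    moreover have "linked ?E {z \<in> ?V. v \<in> ?B z}" if v: "v \<in> \<Union>(insert b \<B>)" for v
    proof (cases "v \<in> \<Union>\<B>")
      case True
      then have S: "linked ?E {z \<in> V. v \<in> B z}" using T(9) linkedE by meson
      show ?thesis
      proof (cases "v \<in> b")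
        case vb: True
        \<comment> \<open>A vertex in \<open>b\<close> and in an older bag lies in \<open>c\<close>,
          so the new node \<open>x\<close> is joined to the old nodes of \<open>v\<close> through
          \<open>y\<close>.\<close>
        then have "v \<in> c" using True rip_insert.hyps(3) by blast
        then have "linked ?E (insert x {z \<in> V. v \<in> B z})"
          using linked_insert_leaf[OF S, of y x] y by blast
        moreover have "{z \<in> ?V. v \<in> ?B z} = insert x {z \<in> V. v \<in> B z}" using x vb by auto
        ultimately show ?thesis by simp
      next
        case False
        then have "{z \<in> ?V. v \<in> ?B z} = {z \<in> V. v \<in> B z}" using x by auto
        with S show ?thesis by simp
      qed
    next
      case False
      then have "{z \<in> ?V. v \<in> ?B z} = {x}" using v T(8) by auto
      then show ?thesis by (auto simp: linked_def)
    qed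
    moreover have "finite ?V" "?E \<subseteq> ?V \<times> ?V" "sym ?E" "irrefl ?E"
      using T(1-4) x y by (auto simp: sym_def irrefl_def)
    ultimately show ?thesis
      by (intro exI[of _ ?V] exI[of _ ?E] exI[of _ ?B] conjI ballI)
  qed
qed

section \<open>Passing between tree-decompositions and families of bags\<close>

lemma pair_graph_sym: "pair_graph T \<Longrightarrow> sym (parcs T)"
  using pair_sym_digraph.pair_sym_arcs[of T]
  by (simp add: pair_graph_def pair_pseudo_graph_def symmetric_def)

lemma pair_graph_irrefl: "pair_graph T \<Longrightarrow> irrefl (parcs T)"
  using pair_loopfree_digraph.pair_no_loops[of T]
  by (force simp: pair_graph_def pair_digraph_def irrefl_def)

lemma pair_graph_finite: "pair_graph T \<Longrightarrow> finite (pverts T)"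
  using pair_fin_digraph.pair_finite_verts[of T]
  by (simp add: pair_graph_def pair_digraph_def)

lemma rip_of_tree_decomposition:
  assumes "tree_decomposition G T B"
  shows "rip (B ` pverts T)" and "\<Union>(B ` pverts T) = pverts G"
proof -
  have T: "pair_graph T" "linked (parcs T) (pverts T)" "acyclic_on (parcs T) (pverts T)"
    using assms by (auto simp: tree_decomposition_def undirected_tree_iff)
  have sub: "B x \<subseteq> pverts G" if "x \<in> pverts T" for x
    using assms that by (auto simp: tree_decomposition_def)
  have linked: "linked (parcs T) {x \<in> pverts T. v \<in> B x}" if "v \<in> pverts G" for v
  proof -
    have "connected (with_proj T \<restriction> {x \<in> pverts T. v \<in> B x})"
      using assms that by (auto simp: tree_decomposition_def)
    then show ?thesis
      using connected_restrict_iff[OF pair_graph_sym[OF T(1)], of "{x \<in> pverts T. v \<in> B x}"] by auto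
  qed
  show "rip (B ` pverts T)"
  proof (rule rip_of_tree[OF _ _ _ T(2,3)])
    fix v assume "v \<in> (\<Union>x\<in>pverts T. B x)"
    then show "linked (parcs T) {x \<in> pverts T. v \<in> B x}" using linked sub by blast
  qed (use T(1) in \<open>simp_all add: pair_graph_finite pair_graph_sym pair_graph_irrefl\<close>)
  \<comment> \<open>Every vertex is in some bag because \<open>linked\<close> includes
    non-emptiness.\<close>
  show "\<Union>(B ` pverts T) = pverts G"
    using sub linked by (fastforce simp: linked_def)
qed

lemma tree_decomposition_of_rip:
  assumes "rip \<B>" "\<Union>\<B> = pverts G" "\<And>v w. (v, w) \<in> parcs G \<Longrightarrow> \<exists>b\<in>\<B>. v \<in> b \<and> w \<in> b"
  obtains T :: "nat pair_pre_digraph" and B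
  where "tree_decomposition G T B" "B ` pverts T = \<B>" "order T = card \<B>"
proof -
  obtain V :: "nat set" and E B where T: "finite V" "E \<subseteq> V \<times> V" "sym E" "irrefl E"
    "linked E V" "acyclic_on E V" "inj_on B V" "B ` V = \<B>"
    "\<forall>v\<in>\<Union>\<B>. linked E {x \<in> V. v \<in> B x}"
    using tree_of_rip[OF assms(1)] by (elim exE conjE)
  let ?T = "\<lparr>pverts = V, parcs = E\<rparr>"
  have "finite E" using T(1,2) finite_subset by blast
  then have pg: "pair_graph ?T"
    using T(1-4) by unfold_locales (auto simp: symmetric_def irrefl_def)
  have "undirected_tree ?T" using pg T by (simp add: undirected_tree_iff)
  moreover have "connected (with_proj ?T \<restriction> {x \<in> V. v \<in> B x})" if "v \<in> pverts G" for v
    using T(9) that assms(2) T(3) connected_restrict_iff[of ?T "{x \<in> V. v \<in> B x}"] by auto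
  moreover have "\<exists>x\<in>V. v \<in> B x \<and> w \<in> B x" if "(v, w) \<in> parcs G" for v w
    using assms(3)[OF that] T(8) by blast
  moreover have "B x \<subseteq> pverts G" if "x \<in> V" for x
    using that T(8) assms(2) by blast
  ultimately have "tree_decomposition G ?T B"
    by (auto simp: tree_decomposition_def)
  moreover have "order ?T = card \<B>"
    using card_image[OF T(7)] T(8) by (simp add: order_def)
  ultimately show thesis using that T(8) by (metis pair_pre_digraph.select_convs(1))
qed

section \<open>Width and treewidth\<close>

lemma tree_decomposition_verts:
  "tree_decomposition G T B \<Longrightarrow> finite (pverts T) \<and> pverts T \<noteq> {}"
  using pair_graph_finite by (auto simp: tree_decomposition_def undirected_tree_iff linked_def)

text \<open>Phrased over the set of bags, since the constructed decomposition is known only through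
  that set.\<close>

lemma width_le_iff:
  assumes "tree_decomposition G T B"
  shows "width T B \<le> w \<longleftrightarrow> (\<forall>b\<in>B ` pverts T. int (card b) \<le> w + 1)"
proof -
  have "width T B \<le> w \<longleftrightarrow> Max ((\<lambda>x. int (card (B x))) ` pverts T) \<le> w + 1"
    by (auto simp: width_def)
  also have "\<dots> \<longleftrightarrow> (\<forall>b\<in>B ` pverts T. int (card b) \<le> w + 1)"
    using tree_decomposition_verts[OF assms] by (subst Max_le_iff) auto
  finally show ?thesis .
qed

text \<open>\<open>LEAST\<close> on integers needs a lower bound to be meaningful. Widths are at
  least -1, so the minimum is found on natural numbers after a shift by one.\<close>

lemma treewidth_attained:
  assumes "pair_graph G"
  obtains T :: "nat pair_pre_digraph" and B
  where "tree_decomposition G T B" "width T B = treewidth G"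
proof -
  define P where "P w \<longleftrightarrow> (\<exists>(T :: nat pair_pre_digraph) B. tree_decomposition G T B \<and> width T B = w)" for w
  have ge: "-1 \<le> w" if "P w" for w
  proof (rule ccontr)
    assume "\<not> -1 \<le> w"
    obtain T :: "nat pair_pre_digraph" and B where TB: "tree_decomposition G T B" "width T B = w"
      using \<open>P w\<close> P_def by blast
    have "int (card (B x)) \<le> w + 1" if "x \<in> pverts T" for x
      using width_le_iff[OF TB(1), of w] TB(2) that by simp
    with tree_decomposition_verts[OF TB(1)] \<open>\<not> -1 \<le> w\<close> show False by force
  qed
  interpret pair_graph G by fact
  \<comment> \<open>The decomposition with the single bag \<open>pverts G\<close> shows that some
    width occurs.\<close>
  obtain T :: "nat pair_pre_digraph" and B where "tree_decomposition G T B"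
    using tree_decomposition_of_rip[OF rip_singleton[of "pverts G"], of G] in_arcsD1 in_arcsD2
    by (metis Sup_insert Sup_empty sup_bot_right singletonI)
  then have "P (width T B)" unfolding P_def by blast
  moreover from this have "-1 \<le> width T B" by (rule ge)
  ultimately have "P (int (nat (width T B + 1)) - 1)" by simp
  then have "P (int (LEAST n. P (int n - 1)) - 1)" (is "P ?m") by (rule LeastI)
  moreover have "?m \<le> w" if "P w" for w
  proof -
    have "P (int (nat (w + 1)) - 1)" using that ge[OF that] by simp
    then have "(LEAST n. P (int n - 1)) \<le> nat (w + 1)" by (rule Least_le)
    with ge[OF that] show ?thesis by linarith
  qed
  ultimately have "P (LEAST w. P w)" by (metis Least_equality)
  then show thesis using that unfolding P_def treewidth_def by blast
qed

theorem theorem3: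
  fixes G :: "'a pair_pre_digraph" and k :: int
  assumes "pair_graph G"
    and "k \<ge> max (treewidth G) 1"
  shows "\<exists>(T :: nat pair_pre_digraph) B.
           tree_decomposition G T B \<and>
           width T B \<le> 3 * k - 1 \<and>
           real (order T) \<le> max (real (card (pverts G)) / real_of_int k - 1) 1"
proof -
  obtain T :: "nat pair_pre_digraph" and B
    where TB: "tree_decomposition G T B" "width T B = treewidth G"
    using treewidth_attained[OF assms(1)] by blast
  define n where "n = nat k"
  have n: "1 \<le> n" "k = int n" using assms(2) by (auto simp: n_def)
  note rip = rip_of_tree_decomposition[OF TB(1)]
  \<comment> \<open>A decomposition of minimum width has width at most \<open>k\<close>, hence bags
    of at most \<open>k + 1\<close> vertices.\<close>
  have small: "card b \<le> n + 1" if "b \<in> B ` pverts T" for b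
    using width_le_iff[OF TB(1), of k] TB(2) assms(2) n that by auto
  have fin: "finite b" if "b \<in> B ` pverts T" for b
    using rip(2) pair_graph_finite[OF assms(1)] that by (metis Sup_upper finite_subset)
  obtain \<C> where \<C>: "few_bags n (pverts G) \<C>" "\<And>b. b \<in> B ` pverts T \<Longrightarrow> \<exists>c\<in>\<C>. b \<subseteq> c"
    using rip_coarsening[OF rip(1) n(1) fin small] unfolding rip(2) by blast
  have edges: "\<exists>c\<in>\<C>. v \<in> c \<and> w \<in> c" if "(v, w) \<in> parcs G" for v w
  proof -
    have "\<exists>x\<in>pverts T. v \<in> B x \<and> w \<in> B x"
      using TB(1) that by (auto simp: tree_decomposition_def)
    then obtain x where "x \<in> pverts T" "v \<in> B x" "w \<in> B x" by blast
    moreover from this obtain c where "c \<in> \<C>" "B x \<subseteq> c" using \<C>(2)[of "B x"] by blast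
    ultimately show ?thesis by blast
  qed
  have "rip \<C>" "\<Union>\<C> = pverts G" using \<C>(1) by (auto simp: few_bags_def)
  then obtain T' :: "nat pair_pre_digraph" and B'
    where T': "tree_decomposition G T' B'" "B' ` pverts T' = \<C>" "order T' = card \<C>"
    by (rule tree_decomposition_of_rip[OF _ _ edges])
  have "width T' B' \<le> 3 * k - 1"
    unfolding width_le_iff[OF T'(1)] T'(2) using \<C>(1) n by (fastforce simp: few_bags_def)
  moreover have "real (order T') \<le> max (real (card (pverts G)) / real_of_int k - 1) 1"
  \<comment> \<open>A single bag is covered by the 1 in the maximum; otherwise the count in
    \<open>few_bags\<close> is divided by \<open>k\<close>.\<close>
  proof (cases "card \<C> \<le> 1")
    case True
    then show ?thesis using T'(3) by simp
  next
    case False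
    then have "n * (card \<C> + 1) \<le> card (pverts G)" using \<C>(1) by (simp add: few_bags_def)
    then have "real n * (real (card \<C>) + 1) \<le> real (card (pverts G))"
      by (metis of_nat_1 of_nat_add of_nat_le_iff of_nat_mult)
    then have "real (card \<C>) + 1 \<le> real (card (pverts G)) / real n"
      using n(1) by (simp add: field_simps)
    then show ?thesis using T'(3) n(2) by simp
  qed
  ultimately show ?thesis using T'(1) by blast
qed

end
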